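(* Let $q>2$ and let $\gamma\in\mathcal{T}_q$, i.e. $\gamma$ is a Borel probability measure on $\mathbb{R}$ for which there is $C<\infty$ with $\log\int_{\mathbb{R}}e^{ty}\gamma(dy)<C|t|^{q/(q-1)}+C$ for all $t\in\mathbb{R}$. Then for all $w\in\mathbb{R}$, $$\mathbb{I}^{\mathsf{an}}_\gamma(w)=\inf_{\nu\in\mathcal{P}(\mathbb{R}):\ m_2(\nu)\le1}\left\{\mathbb{I}^{\mathsf{qu}}_{\gamma,\nu}(w)+H(\nu|\mu_2)+\tfrac12\bigl(1-m_2(\nu)\bigr)\right\}.$$ In particular, for all $w\in\mathbb{R}$, $\mathbb{I}^{\mathsf{an}}_\gamma(w)\le\mathbb{I}^{\mathsf{qu}}_{\gamma,\mu_2}(w)$.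
   Context: $\mathcal{P}(\mathbb{R})$ is the set of Borel probability measures on $\mathbb{R}$; $m_2(\nu)=\int x^2\nu(dx)$; $\mu_2$ is the standard Gaussian measure; $H(\nu|\mu)=\int\log\frac{d\nu}{d\mu}d\nu$ if $\nu\ll\mu$ and $+\infty$ otherwise. Legendre transform: $\Lambda^*(\tau)=\sup_t\{\langle t,\tau\rangle-\Lambda(t)\}$. Define $$\Phi_\gamma(t_0,t_1)=\log\int_{\mathbb{R}}\int_{\mathbb{R}}e^{t_0z^2+t_1zx}\mu_2(dz)\gamma(dx),\qquad\mathbb{I}^{\mathsf{an}}_\gamma(w)=\inf\{\Phi^*_\gamma(\tau_0,\tau_1):\tau_0>0,\tau_1\in\mathbb{R},\ \tau_0^{-1/2}\tau_1=w\},$$ $$\mathrm{M}_\gamma(t)=\int_{\mathbb{R}}e^{ty}\gamma(dy),\qquad\Psi_{\gamma,\nu}(t)=\int_{\mathbb{R}}\log\mathrm{M}_\gamma(tu)\,\nu(du),\qquad\mathbb{I}^{\mathsf{qu}}_{\gamma,\nu}(w)=\Psi^*_{\gamma,\nu}(w).$$ *)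

theory Defs
  imports "HOL-Probability.Probability"
begin

text \<open>
  Logarithmic moment generating functions, entropies and rate functions can be infinite, so all of
  them are \<^typ>\<open>ereal\<close>-valued. Borel probability measures on the real line are the measures
  satisfying \<^const>\<open>real_distribution\<close>.
\<close>

definition log_ennreal :: "ennreal \<Rightarrow> ereal" where
  "log_ennreal x = (if x = 0 then -\<infinity> else if x = \<infinity> then \<infinity> else ereal (ln (enn2real x)))"

text \<open>
  Integral of an extended real function as positive part minus negative part
  (\<^const>\<open>e2ennreal\<close> truncates negative arguments to \<open>0\<close>). If both parts are infinite, the
  integral is undefined in the usual sense and the value here is \<open>\<infinity> - \<infinity> = \<infinity>\<close>. The Bochner
  integral is not suitable, since it is \<open>0\<close> for functions whose integral is infinite.
\<close>

definition ereal_integral :: "'a measure \<Rightarrow> ('a \<Rightarrow> ereal) \<Rightarrow> ereal" where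
  "ereal_integral M f =
     enn2ereal (\<integral>\<^sup>+ x. e2ennreal (f x) \<partial>M) - enn2ereal (\<integral>\<^sup>+ x. e2ennreal (- f x) \<partial>M)"

definition std_gaussian :: "real measure" where
  "std_gaussian = density lborel (\<lambda>x. ennreal (std_normal_density x))"

definition second_moment :: "real measure \<Rightarrow> ennreal" where
  "second_moment \<nu> = (\<integral>\<^sup>+ x. ennreal (x\<^sup>2) \<partial>\<nu>)"

definition relative_entropy :: "'a measure \<Rightarrow> 'a measure \<Rightarrow> ereal" where
  "relative_entropy \<nu> \<mu> =
     (if absolutely_continuous \<mu> \<nu> then ereal_integral \<nu> (\<lambda>x. log_ennreal (RN_deriv \<mu> \<nu> x)) else \<infinity>)"

definition legendre_transform :: "('a::real_inner \<Rightarrow> ereal) \<Rightarrow> 'a \<Rightarrow> ereal" where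
  "legendre_transform \<Lambda> \<tau> = (SUP t. ereal (t \<bullet> \<tau>) - \<Lambda> t)"

definition mgf :: "real measure \<Rightarrow> real \<Rightarrow> ennreal" where
  "mgf \<gamma> t = (\<integral>\<^sup>+ y. ennreal (exp (t * y)) \<partial>\<gamma>)"

definition tail_class :: "real \<Rightarrow> real measure set" where
  "tail_class q = {\<gamma>. real_distribution \<gamma> \<and>
     (\<exists>C::real. \<forall>t::real. log_ennreal (mgf \<gamma> t) < ereal (C * \<bar>t\<bar> powr (q / (q - 1)) + C))}"

definition Phi :: "real measure \<Rightarrow> real \<times> real \<Rightarrow> ereal" where
  "Phi \<gamma> = (\<lambda>(t0, t1).
     log_ennreal (\<integral>\<^sup>+ x. (\<integral>\<^sup>+ z. ennreal (exp (t0 * z\<^sup>2 + t1 * z * x)) \<partial>std_gaussian) \<partial>\<gamma>))"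

definition rate_an :: "real measure \<Rightarrow> real \<Rightarrow> ereal" where
  "rate_an \<gamma> w =
     Inf {legendre_transform (Phi \<gamma>) (\<tau>0, \<tau>1) | \<tau>0 \<tau>1. \<tau>0 > 0 \<and> \<tau>0 powr (- 1 / 2) * \<tau>1 = w}"

definition Psi :: "real measure \<Rightarrow> real measure \<Rightarrow> real \<Rightarrow> ereal" where
  "Psi \<gamma> \<nu> t = ereal_integral \<nu> (\<lambda>u. log_ennreal (mgf \<gamma> (t * u)))"

definition rate_qu :: "real measure \<Rightarrow> real measure \<Rightarrow> real \<Rightarrow> ereal" where
  "rate_qu \<gamma> \<nu> = legendre_transform (Psi \<gamma> \<nu>)"

end

theory Submission
  imports Defs
begin

text \<open>
  Rescaling \<open>z\<close> shows that the infimum defining the annealed rate is attained at \<open>\<tau>0 = 1\<close>, so the claim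
  concerns \<open>\<Phi>\<^sup>*(1, w)\<close>. The entropy inequality \<open>\<Phi>(t0, t1) \<ge> t0 m\<^sub>2(\<nu>) + \<Psi>\<^sub>\<nu>(t1) - H(\<nu>|\<mu>\<^sub>2)\<close> and the fact that
  \<open>\<Phi>\<close> is infinite for \<open>t0 \<ge> 1/2\<close> bound \<open>\<Phi>\<^sup>*(1, w)\<close> by the value at every competitor \<open>\<nu>\<close>.
  Conversely, for \<open>t0 < 1/2\<close> put \<open>b = sqrt (1 - 2 t0)\<close> and \<open>r = t1 / b\<close>; then
  \<open>\<Phi> = ln (\<integral> exp (r\<^sup>2 x\<^sup>2 / 2) d\<gamma>) - ln b\<close>, and from this one sees that the supremum \<open>\<Phi>\<^sup>*(1, w)\<close> is
  either infinite or attained. If it is attained, the correspondingly tilted Gaussian has second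
  moment \<open>1\<close> and yields equality.
\<close>

section \<open>Extended real logarithms and integrals\<close>

lemma log_ennreal_exp [simp]: "log_ennreal (ennreal (exp x)) = ereal x"
  by (simp add: log_ennreal_def)

lemma log_ennreal_top [simp]: "log_ennreal \<top> = \<infinity>"
  by (simp add: log_ennreal_def)

lemma ennreal_exp_ln_enn2real:
  assumes "x \<noteq> 0" "x < \<infinity>"
  shows "x = ennreal (exp (ln (enn2real x)))"
  using assms by (cases x) (auto simp: ennreal_eq_0_iff not_le)

lemma ereal_integral_cong_AE:
  assumes "AE x in M. f x = g x"
  shows "ereal_integral M f = ereal_integral M g"
proof -
  have "(\<integral>\<^sup>+ x. e2ennreal (f x) \<partial>M) = (\<integral>\<^sup>+ x. e2ennreal (g x) \<partial>M)"
       "(\<integral>\<^sup>+ x. e2ennreal (- f x) \<partial>M) = (\<integral>\<^sup>+ x. e2ennreal (- g x) \<partial>M)"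
    using assms by (auto intro!: nn_integral_cong_AE)
  then show ?thesis by (simp add: ereal_integral_def)
qed

lemma ereal_integral_ereal:
  assumes "integrable M f"
  shows "ereal_integral M (\<lambda>x. ereal (f x)) = ereal (integral\<^sup>L M f)"
proof -
  obtain a b where a: "(\<integral>\<^sup>+ x. ennreal (f x) \<partial>M) = ennreal a" "a \<ge> 0"
    and b: "(\<integral>\<^sup>+ x. ennreal (- f x) \<partial>M) = ennreal b" "b \<ge> 0"
    using assms unfolding real_integrable_def
    by (metis ennreal_cases infinity_ennreal_def)
  show ?thesis
    unfolding ereal_integral_def real_lebesgue_integral_def[OF assms]
    using a b by (simp add: enn2ereal_ennreal)
qed

section \<open>Gaussian exponential integrals and a limit of exponential moments\<close>

lemma prob_space_std_gaussian: "prob_space std_gaussian"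
  unfolding std_gaussian_def using prob_space_normal_density[of 1 0] by simp

lemma sets_std_gaussian [simp, measurable_cong]: "sets std_gaussian = sets borel"
  by (simp add: std_gaussian_def)

lemma space_std_gaussian [simp]: "space std_gaussian = UNIV"
  by (simp add: std_gaussian_def)

lemma real_distribution_std_gaussian: "real_distribution std_gaussian"
  by (intro real_distribution.intro prob_space_std_gaussian real_distribution_axioms.intro) simp

text \<open>Completing the square turns density times integrand into a multiple of the normal
  density with mean \<open>s / a\<close> and variance \<open>1 / a\<close>, where
  \<open>a = 1 - 2*t0 > 0\<close>. The multiple is written as an exponential so that its logarithm
  can be read off.\<close>

lemma nn_integral_std_gaussian_exp_square:
  assumes "t0 < 1/2"
  shows "(\<integral>\<^sup>+ z. ennreal (exp (t0 * z\<^sup>2 + s * z)) \<partial>std_gaussian)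
       = ennreal (exp ((s / sqrt (1 - 2*t0))\<^sup>2 / 2 - ln (1 - 2*t0) / 2))"
proof -
  define a where "a = 1 - 2*t0"
  have a: "a > 0" and t0: "t0 = (1 - a) / 2" using assms by (auto simp: a_def)
  define \<sigma> where "\<sigma> = 1 / sqrt a"
  have \<sigma>: "\<sigma> > 0" "\<sigma>\<^sup>2 = 1 / a" using a by (auto simp: \<sigma>_def power_divide)
  let ?c = "exp (s\<^sup>2 / (2*a)) / sqrt a"
  have c: "?c = exp ((s / sqrt a)\<^sup>2 / 2 - ln a / 2)"
  proof -
    have "exp (ln a / 2) = sqrt a" using a by (simp flip: ln_sqrt)
    then show ?thesis using a by (simp add: exp_diff power_divide mult.commute)
  qed
  have *: "std_normal_density z * exp (t0 * z\<^sup>2 + s * z) = ?c * normal_density (s / a) \<sigma> z" for z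
  proof -
    have "- z\<^sup>2 / 2 + (t0 * z\<^sup>2 + s * z) = s\<^sup>2 / (2*a) + - (z - s/a)\<^sup>2 / (2 * \<sigma>\<^sup>2)"
      using a unfolding \<sigma>(2) t0 by (simp add: field_simps power2_eq_square)
    then have "exp (- z\<^sup>2 / 2) * exp (t0 * z\<^sup>2 + s * z) = exp (s\<^sup>2 / (2*a)) * exp (- (z - s/a)\<^sup>2 / (2 * \<sigma>\<^sup>2))"
      by (simp only: flip: exp_add)
    moreover have "1 / sqrt (2 * pi * \<sigma>\<^sup>2) = sqrt a / sqrt (2*pi)"
      unfolding \<sigma>(2) by (simp add: real_sqrt_divide real_sqrt_mult)
    ultimately show ?thesis
      using a unfolding std_normal_density_def unfolding normal_density_def by simp
  qed
  have "(\<integral>\<^sup>+ z. ennreal (exp (t0 * z\<^sup>2 + s * z)) \<partial>std_gaussian)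
     = (\<integral>\<^sup>+ z. ennreal ?c * ennreal (normal_density (s/a) \<sigma> z) \<partial>lborel)"
    unfolding std_gaussian_def
    by (subst nn_integral_density) (auto simp: * ennreal_mult[symmetric] a less_imp_le intro!: nn_integral_cong)
  also have "\<dots> = ennreal ?c * (\<integral>\<^sup>+ z. ennreal (normal_density (s/a) \<sigma> z) \<partial>lborel)"
    by (rule nn_integral_cmult) simp
  also have "(\<integral>\<^sup>+ z. ennreal (normal_density (s/a) \<sigma> z) \<partial>lborel) = 1"
    using \<sigma>(1) by (subst nn_integral_eq_integral) auto
  finally show ?thesis using c by (simp add: a_def)
qed

text \<open>On the half-line where \<open>s * z \<ge> 0\<close>, the exponential outweighs the
  Gaussian decay, so the Lebesgue integrand stays above \<open>1 / sqrt (2*pi)\<close> on a set of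
  infinite measure.\<close>

lemma nn_integral_std_gaussian_exp_square_top:
  assumes "t0 \<ge> 1/2"
  shows "(\<integral>\<^sup>+ z. ennreal (exp (t0 * z\<^sup>2 + s * z)) \<partial>std_gaussian) = \<top>"
proof -
  define S where "S = (if s \<ge> 0 then {0..} else {..0::real})"
  have [measurable]: "S \<in> sets borel" by (simp add: S_def)
  let ?c = "1 / sqrt (2*pi)"
  have "?c \<le> std_normal_density z * exp (t0 * z\<^sup>2 + s * z)" if "z \<in> S" for z
  proof -
    have "s * z \<ge> 0" using that by (auto split: if_splits simp: S_def mult_nonpos_nonpos)
    moreover have "z\<^sup>2 / 2 \<le> t0 * z\<^sup>2" using assms mult_right_mono[of "1/2" t0 "z\<^sup>2"] by simp
    ultimately have "1 \<le> exp (- z\<^sup>2 / 2) * exp (t0 * z\<^sup>2 + s * z)" by (simp flip: exp_add)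
    then show ?thesis by (simp add: std_normal_density_def field_simps)
  qed
  then have "ennreal ?c * indicator S z \<le> ennreal (std_normal_density z) * ennreal (exp (t0 * z\<^sup>2 + s * z))" for z
    by (cases "z \<in> S") (auto simp: ennreal_mult[symmetric] intro!: ennreal_leI)
  then have "(\<integral>\<^sup>+ z. ennreal ?c * indicator S z \<partial>lborel)
      \<le> (\<integral>\<^sup>+ z. ennreal (std_normal_density z) * ennreal (exp (t0 * z\<^sup>2 + s * z)) \<partial>lborel)"
    by (rule nn_integral_mono)
  also have "\<dots> = (\<integral>\<^sup>+ z. ennreal (exp (t0 * z\<^sup>2 + s * z)) \<partial>std_gaussian)"
    unfolding std_gaussian_def by (subst nn_integral_density) auto
  finally have "(\<integral>\<^sup>+ z. ennreal ?c * indicator S z \<partial>lborel) \<le> \<dots>" .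
  moreover have "emeasure lborel S = \<infinity>"
  proof -
    have "of_nat n \<le> emeasure lborel S" for n
      using emeasure_mono[of "if s \<ge> 0 then {0..real n} else {- real n..0}" S lborel]
      by (auto simp: S_def ennreal_of_nat_eq_real_of_nat split: if_splits)
    then show ?thesis by (metis ennreal_Ex_less_of_nat infinity_ennreal_def less_top linorder_not_le)
  qed
  ultimately show ?thesis
    by (simp add: nn_integral_cmult_indicator ennreal_mult_top top_unique)
qed

text \<open>The optimality conditions below come from dividing by \<open>\<epsilon>\<close> and letting \<open>\<epsilon> \<rightarrow> 0\<close>; the quotient
  \<open>(exp (\<epsilon> * g) - 1) / \<epsilon>\<close> stays between \<open>g\<close> and \<open>exp g - 1\<close>, which dominates it.\<close>

lemma (in prob_space) expectation_ge_of_exp_scaled: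
  fixes g :: "'a \<Rightarrow> real"
  assumes g: "integrable M g" and eg: "integrable M (\<lambda>x. exp (g x))"
    and le: "\<And>\<epsilon>. 0 < \<epsilon> \<Longrightarrow> \<epsilon> \<le> 1 \<Longrightarrow> ennreal (exp (\<epsilon> * c)) \<le> (\<integral>\<^sup>+ x. ennreal (exp (\<epsilon> * g x)) \<partial>M)"
  shows "c \<le> expectation g"
proof -
  note [measurable] = borel_measurable_integrable[OF g]
  \<comment> \<open>\<open>Suc n\<close> keeps \<open>\<epsilon> = 1 / Suc n\<close> in (0, 1], the
    range covered by \<open>le\<close> and by the convexity bound.\<close>
  define d where "d n x = (exp (g x / real (Suc n)) - 1) * real (Suc n)" for n x
  have lower: "g x \<le> d n x" for n x
    using mult_right_mono[OF exp_ge_add_one_self[of "g x / real (Suc n)"], of "real (Suc n)"]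
    by (simp add: d_def algebra_simps add_divide_distrib del: of_nat_Suc)
  have upper: "d n x \<le> exp (g x) - 1" for n x
  proof -
    let ?e = "1 / real (Suc n)"
    have "exp ((1 - ?e) *\<^sub>R 0 + ?e *\<^sub>R g x) \<le> (1 - ?e) * exp 0 + ?e * exp (g x)"
      by (rule convex_onD[OF exp_convex]) auto
    from mult_right_mono[OF this, of "real (Suc n)"]
    show ?thesis by (simp add: d_def algebra_simps del: of_nat_Suc)
  qed
  have bound: "norm (d n x) \<le> \<bar>g x\<bar> + (exp (g x) + 1)" for n x
    using lower[of x n] upper[of n x] exp_gt_zero[of "g x"] by (simp add: abs_if del: exp_gt_zero)
  have lim: "(\<lambda>n. d n x) \<longlonglongrightarrow> g x" for x
  proof -
    have "((\<lambda>h::real. (exp (h * g x) - 1) / h) \<longlongrightarrow> g x) (at 0)"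
    proof -
      have "((\<lambda>h. exp (h * g x)) has_real_derivative g x) (at 0)"
        by (auto intro!: derivative_eq_intros)
      then show ?thesis by (simp add: DERIV_def)
    qed
    then have "(\<lambda>n. (exp (inverse (real (Suc n)) * g x) - 1) / inverse (real (Suc n))) \<longlonglongrightarrow> g x"
      by (rule filterlim_compose) (auto simp: filterlim_at LIMSEQ_inverse_real_of_nat simp del: of_nat_Suc intro!: always_eventually)
    then show ?thesis by (simp add: d_def field_simps del: of_nat_Suc)
  qed
  have dom: "integrable M (\<lambda>x. \<bar>g x\<bar> + (exp (g x) + 1))"
    using g eg by auto
  have [measurable]: "d n \<in> borel_measurable M" for n unfolding d_def by measurable
  have int: "integrable M (d n)" for n
    by (rule Bochner_Integration.integrable_bound[OF dom]) (use bound in \<open>auto intro!: always_eventually order_trans[OF bound]\<close>)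
  have "(\<lambda>n. expectation (d n)) \<longlonglongrightarrow> expectation g"
    by (rule integral_dominated_convergence[where w = "\<lambda>x. \<bar>g x\<bar> + (exp (g x) + 1)"])
       (use lim bound dom in auto)
  \<comment> \<open>With \<open>\<epsilon> = 1 / Suc n\<close>, the left side of \<open>le\<close>
    is at least \<open>1 + \<epsilon> * c\<close>, and the right side equals
    \<open>1 + \<epsilon> * expectation (d n)\<close>.\<close>
  moreover have "c \<le> expectation (d n)" for n
  proof -
    let ?e = "1 / real (Suc n)"
    have e: "exp (?e * g x) = 1 + d n x * ?e" for x by (simp add: d_def del: of_nat_Suc)
    have ie: "integrable M (\<lambda>x. exp (?e * g x))" unfolding e using int by simp
    have "ennreal (exp (?e * c)) \<le> ennreal (expectation (\<lambda>x. exp (?e * g x)))"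
      using le[of ?e] ie by (subst nn_integral_eq_integral[symmetric]) auto
    then have "exp (?e * c) \<le> expectation (\<lambda>x. exp (?e * g x))"
      by (subst (asm) ennreal_le_iff) (auto intro!: integral_nonneg)
    also have "\<dots> = 1 + expectation (d n) * ?e" unfolding e using int by (simp add: prob_space)
    finally have "1 + ?e * c \<le> 1 + expectation (d n) * ?e"
      using exp_ge_add_one_self[of "?e * c"] by linarith
    then show ?thesis by (simp add: divide_le_cancel del: of_nat_Suc)
  qed
  ultimately show ?thesis by (intro LIMSEQ_le_const) auto
qed

section \<open>Cumulant generating functions of light-tailed measures\<close>

text \<open>The form in which the tail class enters. Arbitrarily small \<epsilon> is what makes
  \<open>exp ((r * x)\<^sup>2 / 2)\<close> integrable for every \<open>r\<close>.\<close>

locale light_tailed = real_distribution \<gamma> for \<gamma> :: "real measure" +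
  assumes mgf_quadratic_bound: "0 < \<epsilon> \<Longrightarrow> \<exists>K. \<forall>s. mgf \<gamma> s \<le> ennreal (exp (\<epsilon> * s\<^sup>2 + K))"
begin

lemma prob_UNIV [simp]: "prob UNIV = 1"
  using prob_space by simp

definition cgf :: "real \<Rightarrow> real" where
  "cgf s = ln (enn2real (mgf \<gamma> s))"

lemma mgf_finite: "mgf \<gamma> s < \<infinity>"
  using mgf_quadratic_bound[of 1] by (auto intro: le_less_trans)

lemma mgf_eq: "mgf \<gamma> s = ennreal (exp (cgf s))"
  unfolding cgf_def
proof (rule ennreal_exp_ln_enn2real)
  show "mgf \<gamma> s \<noteq> 0"
    unfolding mgf_def by (subst nn_integral_0_iff_AE) (auto simp: AE_False ennreal_eq_0_iff not_le)
qed (rule mgf_finite)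

lemma log_mgf_eq: "log_ennreal (mgf \<gamma> s) = ereal (cgf s)"
  by (simp add: mgf_eq)

lemma integrable_exp: "integrable \<gamma> (\<lambda>y. exp (s * y))"
  by (intro integrableI_nonneg) (use mgf_finite[of s] in \<open>auto simp: mgf_def\<close>)

lemma expectation_exp: "expectation (\<lambda>y. exp (s * y)) = exp (cgf s)"
proof -
  have "ennreal (expectation (\<lambda>y. exp (s * y))) = mgf \<gamma> s"
    unfolding mgf_def by (subst nn_integral_eq_integral[OF integrable_exp]) auto
  then show ?thesis by (simp add: mgf_eq ennreal_inj integral_nonneg)
qed

lemma cgf_upper:
  assumes "\<epsilon> > 0" obtains K where "\<And>s. cgf s \<le> \<epsilon> * s\<^sup>2 + K"
  using mgf_quadratic_bound[OF assms] by (auto simp: mgf_eq)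

lemma cgf_0 [simp]: "cgf 0 = 0"
  using expectation_exp[of 0] by simp

lemma integrable_ident: "integrable \<gamma> (\<lambda>y. y)"
proof (rule Bochner_Integration.integrable_bound)
  show "integrable \<gamma> (\<lambda>y. exp (1 * y) + exp ((- 1) * y))"
    by (intro Bochner_Integration.integrable_add integrable_exp)
  have "\<bar>y\<bar> \<le> exp y + exp (- y)" for y :: real
    using exp_ge_add_one_self[of y] exp_ge_add_one_self[of "- y"] exp_gt_zero[of y] exp_gt_zero[of "- y"]
    by linarith
  then show "AE y in \<gamma>. norm y \<le> norm (exp (1 * y) + exp ((- 1) * y))"
    by (auto intro!: always_eventually order_trans[OF _ abs_ge_self])
qed auto

text \<open>Jensen's inequality, obtained by integrating the tangent line of \<open>exp\<close> at
  \<open>s * ?m\<close>.\<close>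

lemma cgf_lower: "s * expectation (\<lambda>y. y) \<le> cgf s"
proof -
  let ?m = "expectation (\<lambda>y. y)"
  have "exp (s * ?m) * (1 + (s * y - s * ?m)) \<le> exp (s * y)" for y
    using mult_left_mono[OF exp_ge_add_one_self[of "s * y - s * ?m"], of "exp (s * ?m)"]
    by (simp flip: exp_add)
  then have "expectation (\<lambda>y. exp (s * ?m) * (1 + (s * y - s * ?m))) \<le> exp (cgf s)"
    unfolding expectation_exp[symmetric]
    by (intro integral_mono integrable_exp integrable_mult_right Bochner_Integration.integrable_add
        Bochner_Integration.integrable_diff integrable_ident) auto
  moreover have "expectation (\<lambda>y. exp (s * ?m) * (1 + (s * y - s * ?m))) = exp (s * ?m)"
    using integrable_ident by (simp add: prob_space)
  ultimately show ?thesis by simp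
qed

text \<open>Quadratic growth on both sides makes \<open>cgf (t * u)\<close> integrable under every
  law with finite second moment. The upper side is the quadratic bound with \<epsilon> = 1, the
  lower side the linear bound \<open>cgf_lower\<close>.\<close>

lemma abs_cgf_bound:
  obtains K where "K \<ge> 0" "\<And>s. \<bar>cgf s\<bar> \<le> K * (s\<^sup>2 + 1)"
proof -
  obtain K where K: "\<And>s. cgf s \<le> 1 * s\<^sup>2 + K" using cgf_upper[of 1] by auto
  let ?m = "\<bar>expectation (\<lambda>y. y)\<bar>"
  let ?K = "max (max 1 \<bar>K\<bar>) ?m"
  have "\<bar>cgf s\<bar> \<le> ?K * (s\<^sup>2 + 1)" for s
  proof (rule abs_leI)
    have "1 * s\<^sup>2 \<le> ?K * s\<^sup>2" by (rule mult_right_mono) auto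
    then show "cgf s \<le> ?K * (s\<^sup>2 + 1)" using K[of s] by (simp add: algebra_simps) linarith
    have "\<bar>s\<bar> \<le> s\<^sup>2 + 1"
      using zero_le_power2[of "\<bar>s\<bar> - 1"] by (simp add: power2_diff)
    then have "\<bar>s\<bar> * ?m \<le> (s\<^sup>2 + 1) * ?K"
      by (intro mult_mono) auto
    then show "- cgf s \<le> ?K * (s\<^sup>2 + 1)"
      using cgf_lower[of s] abs_ge_minus_self[of "s * expectation (\<lambda>y. y)"]
      by (simp add: abs_mult mult.commute)
  qed
  then show ?thesis by (intro that[of ?K]) auto
qed

lemma cgf_convex: "convex_on UNIV cgf"
proof (rule convex_onI)
  fix t u v :: real assume t: "0 < t" "t < 1"
  \<comment> \<open>After normalization, \<open>exp (u * y - cgf u)\<close> and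
    \<open>exp (v * y - cgf v)\<close> have mean 1; pointwise convexity of \<open>exp\<close> in the
    exponent then replaces Hoelder's inequality.\<close>
  have "exp (((1 - t) * u + t * v) * y - ((1 - t) * cgf u + t * cgf v))
      \<le> (1 - t) * (exp (- cgf u) * exp (u * y)) + t * (exp (- cgf v) * exp (v * y))" for y
    using convex_onD[OF exp_convex, of t "u * y - cgf u" "v * y - cgf v"] t
    by (simp add: algebra_simps flip: exp_add)
  then have "expectation (\<lambda>y. exp (((1 - t) * u + t * v) * y - ((1 - t) * cgf u + t * cgf v)))
     \<le> expectation (\<lambda>y. (1 - t) * (exp (- cgf u) * exp (u * y)) + t * (exp (- cgf v) * exp (v * y)))"
    by (intro integral_mono) (auto intro!: integrable_exp simp: exp_diff)
  also have "\<dots> = 1"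
    using integrable_exp by (simp add: expectation_exp exp_minus)
  also have "expectation (\<lambda>y. exp (((1 - t) * u + t * v) * y - ((1 - t) * cgf u + t * cgf v)))
     = exp (cgf ((1 - t) * u + t * v) - ((1 - t) * cgf u + t * cgf v))"
    by (simp add: expectation_exp exp_diff)
  finally show "cgf ((1 - t) *\<^sub>R u + t *\<^sub>R v) \<le> (1 - t) * cgf u + t * cgf v" by simp
qed auto

lemma cgf_measurable [measurable]: "cgf \<in> borel_measurable borel"
  by (intro borel_measurable_continuous_onI convex_on_continuous[OF open_UNIV cgf_convex])

text \<open>Convexity along the segment from \<open>t * z\<close> to \<open>(t + s) * z\<close>; it
  brings increments of \<open>cgf\<close> into the scaled form that
  \<open>expectation_ge_of_exp_scaled\<close> asks for.\<close>

lemma cgf_increment_le: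
  assumes "0 \<le> \<epsilon>" "\<epsilon> \<le> 1"
  shows "cgf ((t + \<epsilon> * s) * z) - cgf (t * z) \<le> \<epsilon> * (cgf ((t + s) * z) - cgf (t * z))"
  using convex_onD[OF cgf_convex assms, of "t * z" "(t + s) * z"] by (simp add: algebra_simps)

lemma integrable_cgf_mult:
  assumes "real_distribution \<nu>" "integrable \<nu> (\<lambda>u. u\<^sup>2)"
  shows "integrable \<nu> (\<lambda>u. cgf (t * u))"
proof -
  interpret \<nu>: real_distribution \<nu> by fact
  obtain K where K: "K \<ge> 0" "\<And>s. \<bar>cgf s\<bar> \<le> K * (s\<^sup>2 + 1)" using abs_cgf_bound by blast
  show ?thesis
  proof (rule Bochner_Integration.integrable_bound)
    show "integrable \<nu> (\<lambda>u. K * (t\<^sup>2 * u\<^sup>2 + 1))" using assms(2) by auto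
    show "AE u in \<nu>. norm (cgf (t * u)) \<le> norm (K * (t\<^sup>2 * u\<^sup>2 + 1))"
      using K(2)[of "t * _"]
      by (auto intro!: always_eventually order_trans[OF _ abs_ge_self] simp: power_mult_distrib)
  qed auto
qed

lemma Psi_eq:
  assumes "real_distribution \<nu>" "integrable \<nu> (\<lambda>u. u\<^sup>2)"
  shows "Psi \<gamma> \<nu> t = ereal (\<integral>u. cgf (t * u) \<partial>\<nu>)"
  unfolding Psi_def log_mgf_eq by (rule ereal_integral_ereal[OF integrable_cgf_mult[OF assms]])

text \<open>The choice \<open>t = 0\<close> contributes 0 to the supremum. This excludes the value
  -\<infinity> when the rate is added to an entropy.\<close>

lemma rate_qu_nonneg:
  assumes "real_distribution \<nu>" "integrable \<nu> (\<lambda>u. u\<^sup>2)"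
  shows "0 \<le> rate_qu \<gamma> \<nu> w"
  unfolding rate_qu_def legendre_transform_def
  by (rule SUP_upper2[of 0]) (auto simp: Psi_eq[OF assms])

text \<open>The double integral defining \<open>Phi\<close> can be computed in either order: integrating over \<open>x\<close>
  first produces \<open>cgf\<close>, integrating over \<open>z\<close> first produces \<open>lam\<close> and makes the dependence on \<open>t0\<close>
  explicit.\<close>

lemma double_integral_swap:
  "(\<integral>\<^sup>+ x. (\<integral>\<^sup>+ z. ennreal (exp (t0 * z\<^sup>2 + t1 * z * x)) \<partial>std_gaussian) \<partial>\<gamma>)
   = (\<integral>\<^sup>+ z. ennreal (exp (t0 * z\<^sup>2 + cgf (t1 * z))) \<partial>std_gaussian)"
proof -
  interpret G: prob_space std_gaussian by (rule prob_space_std_gaussian)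
  interpret pair_sigma_finite \<gamma> std_gaussian ..
  have "(\<integral>\<^sup>+ x. (\<integral>\<^sup>+ z. ennreal (exp (t0 * z\<^sup>2 + t1 * z * x)) \<partial>std_gaussian) \<partial>\<gamma>)
      = (\<integral>\<^sup>+ z. (\<integral>\<^sup>+ x. ennreal (exp (t0 * z\<^sup>2 + t1 * z * x)) \<partial>\<gamma>) \<partial>std_gaussian)"
    by (rule Fubini'[symmetric]) measurable
  also have "\<dots> = (\<integral>\<^sup>+ z. ennreal (exp (t0 * z\<^sup>2)) * mgf \<gamma> (t1 * z) \<partial>std_gaussian)"
    unfolding mgf_def by (subst nn_integral_cmult[symmetric]) (auto simp: exp_add ennreal_mult)
  also have "\<dots> = (\<integral>\<^sup>+ z. ennreal (exp (t0 * z\<^sup>2 + cgf (t1 * z))) \<partial>std_gaussian)"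
    by (simp add: mgf_eq exp_add ennreal_mult)
  finally show ?thesis .
qed

section \<open>Closed form of \<open>Phi\<close>\<close>

text \<open>This is \<open>Phi \<gamma> (0, r)\<close>, the log-moment generating function of the
  product of a Gaussian and an independent \<open>\<gamma>\<close>-variable.\<close>

definition lam :: "real \<Rightarrow> real" where
  "lam r = ln (expectation (\<lambda>x. exp ((r * x)\<^sup>2 / 2)))"

text \<open>The integrand is the Gaussian moment generating function at \<open>r * x\<close>.
  Swapping integrals leaves \<open>exp (cgf (r * z))\<close> under the Gaussian, which is integrable
  once \<open>cgf (r * z) \<le> \<epsilon> * r\<^sup>2 * z\<^sup>2 + K\<close> with
  \<open>\<epsilon> * r\<^sup>2 < 1/2\<close>.\<close>

lemma integrable_exp_square: "integrable \<gamma> (\<lambda>x. exp ((r * x)\<^sup>2 / 2))"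
proof (rule integrableI_nonneg)
  define \<epsilon> where "\<epsilon> = 1 / (4 * (r\<^sup>2 + 1))"
  have "r\<^sup>2 + 1 > 0" by (simp add: add_nonneg_pos)
  then have \<epsilon>: "\<epsilon> > 0" "\<epsilon> * r\<^sup>2 < 1 / 2" by (auto simp: \<epsilon>_def field_simps)
  obtain K where K: "\<And>s. cgf s \<le> \<epsilon> * s\<^sup>2 + K" using cgf_upper[OF \<epsilon>(1)] by blast
  have "(\<integral>\<^sup>+ x. ennreal (exp ((r * x)\<^sup>2 / 2)) \<partial>\<gamma>)
      = (\<integral>\<^sup>+ x. (\<integral>\<^sup>+ z. ennreal (exp (0 * z\<^sup>2 + r * z * x)) \<partial>std_gaussian) \<partial>\<gamma>)"
    using nn_integral_std_gaussian_exp_square[of 0 "r * x" for x]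
    by (simp add: mult.commute mult.left_commute)
  also have "\<dots> \<le> (\<integral>\<^sup>+ z. ennreal (exp K) * ennreal (exp ((\<epsilon> * r\<^sup>2) * z\<^sup>2 + 0 * z)) \<partial>std_gaussian)"
    unfolding double_integral_swap
    using K[of "r * _"]
    by (intro nn_integral_mono)
       (auto simp: ennreal_mult[symmetric] exp_add[symmetric] power_mult_distrib algebra_simps)
  also have "\<dots> = ennreal (exp K) * (\<integral>\<^sup>+ z. ennreal (exp ((\<epsilon> * r\<^sup>2) * z\<^sup>2 + 0 * z)) \<partial>std_gaussian)"
    by (rule nn_integral_cmult) measurable
  also have "\<dots> < \<infinity>"
    unfolding nn_integral_std_gaussian_exp_square[OF \<epsilon>(2)] by (simp add: ennreal_mult[symmetric])
  finally show "(\<integral>\<^sup>+ x. ennreal (exp ((r * x)\<^sup>2 / 2)) \<partial>\<gamma>) < \<infinity>" .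
qed auto

lemma exp_lam: "exp (lam r) = expectation (\<lambda>x. exp ((r * x)\<^sup>2 / 2))"
proof -
  have "1 \<le> expectation (\<lambda>x. exp ((r * x)\<^sup>2 / 2))"
    using integral_mono[of \<gamma> "\<lambda>_. 1" "\<lambda>x. exp ((r * x)\<^sup>2 / 2)"] integrable_exp_square[of r]
    by (simp add: prob_space)
  then show ?thesis unfolding lam_def by simp
qed

lemma lam_nonneg: "0 \<le> lam r"
proof -
  have "1 \<le> exp (lam r)" unfolding exp_lam
    using integral_mono[of \<gamma> "\<lambda>_. 1" "\<lambda>x. exp ((r * x)\<^sup>2 / 2)"] integrable_exp_square[of r]
    by (simp add: prob_space)
  then show ?thesis by simp
qed

lemma lam_0 [simp]: "lam 0 = 0"
  by (simp add: lam_def prob_space)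

text \<open>The inner Gaussian integral splits into the factor
  \<open>(1 - 2*t0) powr (- 1/2)\<close>, free of \<open>x\<close>, and the integrand of
  \<open>lam\<close> at a rescaled argument.\<close>

lemma double_integral_eq:
  assumes "t0 < 1/2"
  shows "(\<integral>\<^sup>+ x. (\<integral>\<^sup>+ z. ennreal (exp (t0 * z\<^sup>2 + t1 * z * x)) \<partial>std_gaussian) \<partial>\<gamma>)
    = ennreal (exp (lam (t1 / sqrt (1 - 2*t0)) - ln (1 - 2*t0) / 2))"
proof -
  let ?c = "exp (- ln (1 - 2*t0) / 2)" and ?r = "t1 / sqrt (1 - 2*t0)"
  have "(\<integral>\<^sup>+ x. (\<integral>\<^sup>+ z. ennreal (exp (t0 * z\<^sup>2 + t1 * z * x)) \<partial>std_gaussian) \<partial>\<gamma>)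
      = (\<integral>\<^sup>+ x. ennreal (?c * exp ((?r * x)\<^sup>2 / 2)) \<partial>\<gamma>)"
    using nn_integral_std_gaussian_exp_square[OF assms, of "t1 * x" for x]
    by (simp add: mult.commute mult.left_commute flip: exp_add)
  also have "\<dots> = ennreal (?c * expectation (\<lambda>x. exp ((?r * x)\<^sup>2 / 2)))"
    using integrable_exp_square[of ?r] by (subst nn_integral_eq_integral) auto
  also have "\<dots> = ennreal (exp (lam ?r - ln (1 - 2*t0) / 2))"
    unfolding exp_lam[symmetric] by (simp flip: exp_add)
  finally show ?thesis .
qed

lemma Phi_eq:
  assumes "t0 < 1/2"
  shows "Phi \<gamma> (t0, t1) = ereal (lam (t1 / sqrt (1 - 2*t0)) - ln (1 - 2*t0) / 2)"
  unfolding Phi_def using double_integral_eq[OF assms] by simp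

lemma Phi_top:
  assumes "t0 \<ge> 1/2"
  shows "Phi \<gamma> (t0, t1) = \<infinity>"
  unfolding Phi_def using nn_integral_std_gaussian_exp_square_top[OF assms, of "t1 * x" for x]
  by (simp add: mult.commute mult.left_commute emeasure_space_1[simplified])

end

section \<open>From the tail class to quadratic bounds\<close>

lemma mult_powr_le_square:
  fixes C \<epsilon> p x :: real
  assumes "C > 0" "\<epsilon> > 0" "0 \<le> p" "p < 2"
  shows "C * \<bar>x\<bar> powr p \<le> \<epsilon> * x\<^sup>2 + C * ((C / \<epsilon>) powr (1 / (2 - p))) powr p"
proof -
  \<comment> \<open>\<open>R\<close> is the crossover point where
    \<open>C * R powr p = \<epsilon> * R\<^sup>2\<close>: below it the constant dominates the left
    side, above it the square does.\<close>
  define R where "R = (C / \<epsilon>) powr (1 / (2 - p))"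
  have R: "R > 0" using assms by (simp add: R_def)
  show ?thesis
  proof (cases "\<bar>x\<bar> \<le> R")
    case True
    have "\<bar>x\<bar> powr p \<le> R powr p" using True assms by (intro powr_mono2) auto
    then have "C * \<bar>x\<bar> powr p \<le> C * R powr p" using assms by simp
    moreover have "0 \<le> \<epsilon> * x\<^sup>2" using assms by simp
    ultimately show ?thesis by (simp add: R_def)
  next
    case False
    have "C / \<epsilon> = R powr (2 - p)" using assms by (simp add: R_def powr_powr)
    also have "\<dots> \<le> \<bar>x\<bar> powr (2 - p)" using False assms R by (intro powr_mono2) auto
    finally have "C \<le> \<epsilon> * \<bar>x\<bar> powr (2 - p)" using assms by (simp add: field_simps)
    then have "C * \<bar>x\<bar> powr p \<le> \<epsilon> * \<bar>x\<bar> powr (2 - p) * \<bar>x\<bar> powr p"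
      by (rule mult_right_mono) simp
    also have "\<dots> = \<epsilon> * x\<^sup>2"
      using False R by (simp add: mult.assoc flip: powr_add)
    finally have "C * \<bar>x\<bar> powr p \<le> \<epsilon> * x\<^sup>2" .
    moreover have "0 \<le> C * R powr p" using assms by simp
    ultimately show ?thesis by (simp add: R_def)
  qed
qed

lemma le_exp_of_log_ennreal_less:
  assumes "log_ennreal m < ereal c"
  shows "m \<le> ennreal (exp c)"
proof (cases "m = 0")
  case False
  then have "m < \<infinity>" using assms by (auto simp: log_ennreal_def less_top[symmetric] split: if_splits)
  then have "m = ennreal (exp (ln (enn2real m)))" by (rule ennreal_exp_ln_enn2real[OF False])
  moreover have "ln (enn2real m) < c" using assms False \<open>m < \<infinity>\<close> by (auto simp: log_ennreal_def split: if_splits)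
  ultimately show ?thesis by (metis ennreal_leI exp_le_cancel_iff less_imp_le)
qed simp

lemma light_tailed_of_tail_class:
  assumes q: "q > 2" and \<gamma>: "\<gamma> \<in> tail_class q"
  shows "light_tailed \<gamma>"
proof -
  from \<gamma> interpret real_distribution \<gamma> by (simp add: tail_class_def)
  from \<gamma> obtain C where C: "\<And>t. log_ennreal (mgf \<gamma> t) < ereal (C * \<bar>t\<bar> powr (q / (q - 1)) + C)"
    by (auto simp: tail_class_def)
  \<comment> \<open>\<open>q > 2\<close> puts the conjugate exponent \<open>?p\<close> below 2, so
    the square absorbs the power; the maximum with 1 supplies a positive constant.\<close>
  let ?p = "q / (q - 1)" and ?C = "max C 1"
  have p: "0 \<le> ?p" "?p < 2" using q by (auto simp: field_simps)
  show ?thesis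
  proof
    fix \<epsilon> :: real assume \<epsilon>: "\<epsilon> > 0"
    let ?K = "?C * ((?C / \<epsilon>) powr (1 / (2 - ?p))) powr ?p + ?C"
    have "mgf \<gamma> s \<le> ennreal (exp (\<epsilon> * s\<^sup>2 + ?K))" for s
    proof -
      have "C * \<bar>s\<bar> powr ?p + C \<le> ?C * \<bar>s\<bar> powr ?p + ?C"
        by (intro add_mono mult_right_mono) auto
      also have "\<dots> \<le> \<epsilon> * s\<^sup>2 + ?K"
        using mult_powr_le_square[of ?C \<epsilon> ?p s] \<epsilon> p by simp
      finally show ?thesis
        using le_exp_of_log_ennreal_less[OF C[of s]] by (meson ennreal_leI exp_le_cancel_iff order_trans)
    qed
    then show "\<exists>K. \<forall>s. mgf \<gamma> s \<le> ennreal (exp (\<epsilon> * s\<^sup>2 + K))" by blast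
  qed
qed

section \<open>Relative entropy\<close>

text \<open>The Gibbs (Donsker-Varadhan) inequality. With \<open>l\<close> the log-density of \<nu>,
  \<open>exp (g - l)\<close> has \<nu>-mean at most \<open>exp c\<close>, and Jensen's inequality
  gives the bound for \<open>g - l\<close>.\<close>

lemma relative_entropy_variational:
  fixes g :: "'a \<Rightarrow> real"
  assumes "prob_space \<mu>" "prob_space \<nu>" and sets: "sets \<nu> = sets \<mu>"
    and g: "integrable \<nu> g" and c: "(\<integral>\<^sup>+ x. ennreal (exp (g x)) \<partial>\<mu>) \<le> ennreal (exp c)"
  shows "ereal (integral\<^sup>L \<nu> g) \<le> ereal c + relative_entropy \<nu> \<mu>"
proof (cases "absolutely_continuous \<mu> \<nu>")
  case ac: True
  interpret \<mu>: prob_space \<mu> by fact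
  interpret \<nu>: prob_space \<nu> by fact
  have [measurable]: "g \<in> borel_measurable \<mu>"
    using borel_measurable_integrable[OF g] measurable_cong_sets[OF sets refl] by blast
  define R where "R = RN_deriv \<mu> \<nu>"
  have [measurable]: "R \<in> borel_measurable \<mu>" by (simp add: R_def)
  have dens: "density \<mu> R = \<nu>" unfolding R_def by (rule \<mu>.density_RN_deriv[OF ac sets])
  have fin: "AE x in \<mu>. R x \<noteq> \<infinity>" unfolding R_def
    by (rule \<mu>.RN_deriv_finite[OF _ ac sets]) unfold_locales
  then have R\<nu>: "AE x in \<nu>. R x \<noteq> 0 \<and> R x \<noteq> \<infinity>"
    unfolding dens[symmetric] by (subst AE_density) auto
  define l where "l x = ln (enn2real (R x))" for x
  have [measurable]: "l \<in> borel_measurable \<mu>" "l \<in> borel_measurable \<nu>"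
    unfolding l_def measurable_cong_sets[OF sets refl] by measurable
  have "relative_entropy \<nu> \<mu> = ereal_integral \<nu> (\<lambda>x. log_ennreal (R x))"
    by (simp add: relative_entropy_def ac R_def)
  also have "\<dots> = ereal_integral \<nu> (\<lambda>x. ereal (l x))"
    using R\<nu> by (intro ereal_integral_cong_AE) (auto simp: log_ennreal_def l_def)
  finally have H: "relative_entropy \<nu> \<mu> = ereal_integral \<nu> (\<lambda>x. ereal (l x))" .
  \<comment> \<open>Since \<open>- r * ln r \<le> 1\<close>, the negative part of \<open>l\<close>
    has finite integral, so the entropy is infinite whenever the positive part is.\<close>
  have "(\<integral>\<^sup>+ x. ennreal (- l x) \<partial>\<nu>) = (\<integral>\<^sup>+ x. R x * ennreal (- l x) \<partial>\<mu>)"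
    unfolding dens[symmetric] by (rule nn_integral_density) measurable
  also have "\<dots> \<le> (\<integral>\<^sup>+ x. 1 \<partial>\<mu>)"
  proof (rule nn_integral_mono_AE, use fin in eventually_elim)
    fix x assume "R x \<noteq> \<infinity>"
    then obtain r where r: "R x = ennreal r" "r \<ge> 0" by (cases "R x") auto
    show "R x * ennreal (- l x) \<le> 1"
    proof (cases "r = 0")
      case False
      then have "r * (- ln r) \<le> r * (1 / r - 1)"
        using r ln_le_minus_one[of "1/r"] by (intro mult_left_mono) (auto simp: ln_div)
      also have "\<dots> \<le> 1" using False r by (simp add: algebra_simps)
      finally show ?thesis using r by (simp add: l_def flip: ennreal_mult')
    qed (simp add: r)
  qed
  finally have neg: "(\<integral>\<^sup>+ x. ennreal (- l x) \<partial>\<nu>) < \<infinity>"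
    by (simp add: \<mu>.emeasure_space_1 order_le_less_trans)
  show ?thesis
  proof (cases "(\<integral>\<^sup>+ x. ennreal (l x) \<partial>\<nu>) = \<infinity>")
    case True
    then have "relative_entropy \<nu> \<mu> = \<infinity>"
      using neg unfolding H ereal_integral_def
      by (cases "\<integral>\<^sup>+ x. ennreal (- l x) \<partial>\<nu>") (auto simp: enn2ereal_ennreal)
    then show ?thesis by simp
  next
    case False
    then have l: "integrable \<nu> l" using neg by (simp add: real_integrable_def)
    define h where "h x = g x - l x" for x
    have [measurable]: "h \<in> borel_measurable \<mu>" unfolding h_def by measurable
    define m where "m = (\<integral>x. h x \<partial>\<nu>)"
    have gl: "integrable \<nu> h" unfolding h_def using g l by simp
    \<comment> \<open>The density cancels against \<open>exp (- l)\<close> where it is positive and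
      contributes 0 elsewhere, hence only an inequality.\<close>
    have "(\<integral>\<^sup>+ x. ennreal (exp (h x)) \<partial>\<nu>) = (\<integral>\<^sup>+ x. R x * ennreal (exp (h x)) \<partial>\<mu>)"
      unfolding dens[symmetric] by (rule nn_integral_density) measurable
    also have "\<dots> \<le> (\<integral>\<^sup>+ x. ennreal (exp (g x)) \<partial>\<mu>)"
    proof (rule nn_integral_mono_AE, use fin in eventually_elim)
      fix x assume "R x \<noteq> \<infinity>"
      then obtain r where r: "R x = ennreal r" "r \<ge> 0" by (cases "R x") auto
      then show "R x * ennreal (exp (h x)) \<le> ennreal (exp (g x))"
        by (cases "r = 0") (auto simp: h_def l_def exp_diff simp flip: ennreal_mult)
    qed
    also note c
    finally have c': "(\<integral>\<^sup>+ x. ennreal (exp (h x)) \<partial>\<nu>) \<le> ennreal (exp c)" .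
    have ie: "integrable \<nu> (\<lambda>x. exp (h x))"
      using c' gl by (intro integrableI_nonneg) (auto intro: le_less_trans)
    have "exp m * (1 + (h x - m)) \<le> exp (h x)" for x
      using mult_left_mono[OF exp_ge_add_one_self[of "h x - m"], of "exp m"]
      by (simp flip: exp_add)
    then have "(\<integral>x. exp m * (1 + (h x - m)) \<partial>\<nu>) \<le> (\<integral>x. exp (h x) \<partial>\<nu>)"
      using gl ie by (intro integral_mono) auto
    also have "\<dots> \<le> exp c"
      using c' ie by (subst (asm) nn_integral_eq_integral) auto
    also have "(\<integral>x. exp m * (1 + (h x - m)) \<partial>\<nu>) = exp m * (1 + (m - m))"
      using gl by (simp add: \<nu>.prob_space flip: m_def)
    finally have "m \<le> c" by simp
    moreover have "m = integral\<^sup>L \<nu> g - integral\<^sup>L \<nu> l" unfolding m_def h_def using g l by simp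
    ultimately show ?thesis unfolding H ereal_integral_ereal[OF l] by simp
  qed
qed (simp add: relative_entropy_def)

text \<open>Uniqueness of the density identifies the log-density as \<open>f\<close>, so the entropy
  of an exponential tilt is the mean of its exponent.\<close>

lemma relative_entropy_density:
  assumes "prob_space \<mu>" and [measurable]: "f \<in> borel_measurable \<mu>"
    and f: "integrable (density \<mu> (\<lambda>x. ennreal (exp (f x)))) f"
  shows "relative_entropy (density \<mu> (\<lambda>x. ennreal (exp (f x)))) \<mu>
       = ereal (integral\<^sup>L (density \<mu> (\<lambda>x. ennreal (exp (f x)))) f)"
proof -
  interpret prob_space \<mu> by fact
  let ?e = "\<lambda>x. ennreal (exp (f x))"
  let ?\<nu> = "density \<mu> ?e"
  have ac: "absolutely_continuous \<mu> ?\<nu>" by (rule absolutely_continuousI_density) measurable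
  have "AE x in \<mu>. ?e x = RN_deriv \<mu> ?\<nu> x" by (rule RN_deriv_unique) auto
  then have "AE x in ?\<nu>. ?e x = RN_deriv \<mu> ?\<nu> x" by (subst AE_density) auto
  then have "AE x in ?\<nu>. log_ennreal (RN_deriv \<mu> ?\<nu> x) = ereal (f x)"
    by eventually_elim (metis log_ennreal_exp)
  from ereal_integral_cong_AE[OF this] show ?thesis
    by (simp add: relative_entropy_def ac ereal_integral_ereal[OF f])
qed

lemma relative_entropy_self:
  assumes "prob_space \<mu>" shows "relative_entropy \<mu> \<mu> = 0"
proof -
  have eq: "density \<mu> (\<lambda>x. ennreal (exp 0)) = \<mu>" by (simp add: density_1)
  have "relative_entropy (density \<mu> (\<lambda>x. ennreal (exp 0))) \<mu> = ereal (integral\<^sup>L (density \<mu> (\<lambda>x. ennreal (exp 0))) (\<lambda>_. 0))"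
    by (rule relative_entropy_density[OF assms]) auto
  then show ?thesis unfolding eq by simp
qed

section \<open>Second moments\<close>

lemma second_moment_std_gaussian: "second_moment std_gaussian = 1"
proof -
  have "second_moment std_gaussian = (\<integral>\<^sup>+ x. ennreal (std_normal_density x * x^(2*1)) \<partial>lborel)"
    unfolding second_moment_def std_gaussian_def
    by (subst nn_integral_density) (auto simp: ennreal_mult)
  also have "\<dots> = ennreal (fact (2*1) / (2^1 * fact 1))"
    using std_normal_moment_even[of 1]
    by (subst nn_integral_eq_integral) (auto simp: has_bochner_integral_iff)
  finally show ?thesis by simp
qed

lemma second_moment_finite:
  assumes "real_distribution \<nu>" "second_moment \<nu> \<le> 1"
  shows "integrable \<nu> (\<lambda>x. x\<^sup>2)" "second_moment \<nu> = ennreal (\<integral>x. x\<^sup>2 \<partial>\<nu>)" "(\<integral>x. x\<^sup>2 \<partial>\<nu>) \<le> 1"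
proof -
  interpret real_distribution \<nu> by fact
  show i: "integrable \<nu> (\<lambda>x. x\<^sup>2)"
    using assms(2) by (intro integrableI_nonneg) (auto simp: second_moment_def order_le_less_trans)
  show eq: "second_moment \<nu> = ennreal (\<integral>x. x\<^sup>2 \<partial>\<nu>)"
    unfolding second_moment_def by (rule nn_integral_eq_integral[OF i]) auto
  show "(\<integral>x. x\<^sup>2 \<partial>\<nu>) \<le> 1" using assms(2) unfolding eq by simp
qed

section \<open>The Legendre transform of \<open>Phi\<close> at \<open>(1, w)\<close> as a lower
  bound\<close>

context light_tailed
begin

lemma Phi_1_diff_eq:
  "ereal ((t0, t1) \<bullet> (1, w)) - Phi \<gamma> (t0, t1) =
    (if t0 < 1/2 then ereal (t0 + t1 * w - (lam (t1 / sqrt (1 - 2*t0)) - ln (1 - 2*t0) / 2)) else - \<infinity>)"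
  by (simp add: Phi_eq Phi_top)

text \<open>Rescaling \<open>z\<close> by \<open>sqrt \<tau>0\<close> gives
  \<open>\<Phi>\<^sup>*(\<tau>0, \<tau>1) = \<Phi>\<^sup>*(1, w) + (\<tau>0 - 1 - ln \<tau>0) / 2\<close>, so the infimum is attained at \<open>\<tau>0 = 1\<close>.\<close>

lemma rate_an_eq: "rate_an \<gamma> w = legendre_transform (Phi \<gamma>) (1, w)"
proof (rule antisym)
  show "rate_an \<gamma> w \<le> legendre_transform (Phi \<gamma>) (1, w)"
    unfolding rate_an_def by (rule Inf_lower, rule CollectI, rule exI[of _ 1], rule exI[of _ w]) simp
  show "legendre_transform (Phi \<gamma>) (1, w) \<le> rate_an \<gamma> w"
    unfolding rate_an_def
  proof (rule Inf_greatest, clarify)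
    fix \<tau>0 \<tau>1 :: real assume \<tau>: "\<tau>0 > 0" and w_eq: "w = \<tau>0 powr (- 1 / 2) * \<tau>1"
    have w: "w = \<tau>1 / sqrt \<tau>0"
      using \<tau> by (simp add: w_eq powr_minus powr_half_sqrt field_simps)
    show "legendre_transform (Phi \<gamma>) (1, \<tau>0 powr (- 1 / 2) * \<tau>1) \<le> legendre_transform (Phi \<gamma>) (\<tau>0, \<tau>1)"
      unfolding w_eq[symmetric] unfolding legendre_transform_def
    proof (rule SUP_least, clarify)
      fix s0 s1 :: real
      show "ereal ((s0, s1) \<bullet> (1, w)) - Phi \<gamma> (s0, s1)
          \<le> (SUP t. ereal (t \<bullet> (\<tau>0, \<tau>1)) - Phi \<gamma> t)"
      proof (cases "s0 < 1/2")
        case s0: True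
        \<comment> \<open>Chosen so that \<open>1 - 2*t0 = (1 - 2*s0) / \<tau>0\<close>; together
          with \<open>t1\<close> this leaves the argument of \<open>lam\<close> unchanged, and the
          objective gains \<open>(\<tau>0 - 1 - ln \<tau>0) / 2 \<ge> 0\<close>.\<close>
        define t0 where "t0 = 1/2 - (1 - 2 * s0) / (2*\<tau>0)"
        define t1 where "t1 = s1 / sqrt \<tau>0"
        have a: "1 - 2*t0 = (1 - 2 * s0) / \<tau>0" using \<tau> by (simp add: t0_def field_simps)
        moreover have "(1 - 2 * s0) / \<tau>0 > 0" using s0 \<tau> by simp
        ultimately have t0: "t0 < 1/2" by linarith
        have r: "t1 / sqrt (1 - 2*t0) = s1 / sqrt (1 - 2 * s0)"
          unfolding a t1_def using \<tau> by (simp add: real_sqrt_divide)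
        have l: "ln (1 - 2*t0) = ln (1 - 2 * s0) - ln \<tau>0"
          unfolding a using \<tau> s0 by (simp add: ln_div)
        have "t0 * \<tau>0 = \<tau>0 / 2 - 1 / 2 + s0" using \<tau> by (simp add: t0_def field_simps)
        moreover have "t1 * \<tau>1 = s1 * w" by (simp add: t1_def w)
        ultimately have "s0 + s1 * w - (lam (s1 / sqrt (1 - 2 * s0)) - ln (1 - 2 * s0) / 2)
            \<le> t0 * \<tau>0 + t1 * \<tau>1 - (lam (t1 / sqrt (1 - 2*t0)) - ln (1 - 2*t0) / 2)"
          using ln_le_minus_one[OF \<tau>] unfolding r l by (simp add: field_simps)
        then show ?thesis
          by (intro SUP_upper2[of "(t0, t1)"]) (simp_all add: Phi_eq[OF s0] Phi_eq[OF t0])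
      qed (simp add: Phi_top)
    qed
  qed
qed

lemma nn_integral_tilt:
  assumes "t0 < 1/2"
  shows "(\<integral>\<^sup>+ z. ennreal (exp (t0 * z\<^sup>2 + cgf (t1 * z))) \<partial>std_gaussian)
    = ennreal (exp (lam (t1 / sqrt (1 - 2*t0)) - ln (1 - 2*t0) / 2))"
  using double_integral_eq[OF assms] by (simp add: double_integral_swap)

text \<open>Three bounds are added for each \<open>t0 < 1/2\<close>: the entropy inequality for
  \<open>t0 * u\<^sup>2 + cgf (t1 * u)\<close>, the supremum in \<open>rate_qu\<close> evaluated at
  \<open>t1\<close>, and \<open>t0 * (1 - m) \<le> (1 - m) / 2\<close>.\<close>

lemma legendre_Phi_le:
  assumes \<nu>: "real_distribution \<nu>" and m2: "second_moment \<nu> \<le> 1"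
  shows "legendre_transform (Phi \<gamma>) (1, w) \<le> rate_qu \<gamma> \<nu> w + relative_entropy \<nu> std_gaussian
                 + ereal (1 / 2) * (1 - enn2ereal (second_moment \<nu>))"
proof -
  interpret \<nu>: real_distribution \<nu> by fact
  interpret G: prob_space std_gaussian by (rule prob_space_std_gaussian)
  note sm = second_moment_finite[OF \<nu> m2]
  define m where "m = (\<integral>x. x\<^sup>2 \<partial>\<nu>)"
  have m: "m \<ge> 0" "m \<le> 1" using sm by (auto simp: m_def)
  have last: "ereal (1 / 2) * (1 - enn2ereal (second_moment \<nu>)) = ereal ((1 - m) / 2)"
  proof -
    have "1 - ereal m = ereal (1 - m)" by (metis ereal_minus(1) one_ereal_def)
    then show ?thesis unfolding sm(2) m_def[symmetric] using m by (simp add: enn2ereal_ennreal)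
  qed
  have Hnn: "0 \<le> relative_entropy \<nu> std_gaussian"
  proof -
    have "ereal (\<integral>x. 0 \<partial>\<nu>) \<le> ereal 0 + relative_entropy \<nu> std_gaussian"
      by (rule relative_entropy_variational[OF prob_space_std_gaussian \<nu>.prob_space_axioms])
         (use G.emeasure_space_1 in auto)
    then show ?thesis by (simp flip: zero_ereal_def)
  qed
  have qnn: "0 \<le> rate_qu \<gamma> \<nu> w" by (rule rate_qu_nonneg[OF \<nu> sm(1)])
  show ?thesis
    unfolding last unfolding legendre_transform_def
  proof (rule SUP_least, clarify)
    fix t0 t1 :: real
    show "ereal ((t0, t1) \<bullet> (1, w)) - Phi \<gamma> (t0, t1)
        \<le> rate_qu \<gamma> \<nu> w + relative_entropy \<nu> std_gaussian + ereal ((1 - m) / 2)"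
    proof (cases "t0 < 1/2")
      case t0: True
      let ?P = "lam (t1 / sqrt (1 - 2*t0)) - ln (1 - 2*t0) / 2"
      let ?\<psi> = "\<integral>u. cgf (t1 * u) \<partial>\<nu>"
      have "ereal (\<integral>u. t0 * u\<^sup>2 + cgf (t1 * u) \<partial>\<nu>) \<le> ereal ?P + relative_entropy \<nu> std_gaussian"
        by (rule relative_entropy_variational[OF prob_space_std_gaussian \<nu>.prob_space_axioms])
           (use nn_integral_tilt[OF t0, of t1] integrable_cgf_mult[OF \<nu> sm(1), of t1] sm(1) in auto)
      moreover have "(\<integral>u. t0 * u\<^sup>2 + cgf (t1 * u) \<partial>\<nu>) = t0 * m + ?\<psi>"
        using integrable_cgf_mult[OF \<nu> sm(1), of t1] sm(1) by (simp add: m_def)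
      ultimately have 1: "ereal (t0 * m + ?\<psi>) \<le> ereal ?P + relative_entropy \<nu> std_gaussian" by simp
      have "ereal (t1 \<bullet> w) - Psi \<gamma> \<nu> t1 \<le> rate_qu \<gamma> \<nu> w"
        unfolding rate_qu_def legendre_transform_def by (rule SUP_upper) simp
      then have 2: "ereal (t1 * w - ?\<psi>) \<le> rate_qu \<gamma> \<nu> w" by (simp add: Psi_eq[OF \<nu> sm(1)])
      \<comment> \<open>The constraint \<open>m \<le> 1\<close> enters here; the slack
        \<open>(1 - m) / 2\<close> is the limit of the left side as \<open>t0\<close> tends to
        1/2.\<close>
      have "t0 * (1 - m) \<le> 1/2 * (1 - m)" using t0 m by (intro mult_right_mono) auto
      then have 3: "t0 - t0 * m \<le> (1 - m) / 2" by (simp add: algebra_simps)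
      show ?thesis
      proof (cases "rate_qu \<gamma> \<nu> w = \<infinity> \<or> relative_entropy \<nu> std_gaussian = \<infinity>")
        case False
        then obtain a h where ah: "rate_qu \<gamma> \<nu> w = ereal a" "relative_entropy \<nu> std_gaussian = ereal h"
          using Hnn qnn by (cases "rate_qu \<gamma> \<nu> w"; cases "relative_entropy \<nu> std_gaussian") auto
        have "t0 * m + ?\<psi> \<le> ?P + h" "t1 * w - ?\<psi> \<le> a" using 1 2 by (simp_all add: ah)
        then have "t0 + t1 * w - ?P \<le> a + h + (1 - m) / 2" using 3 by linarith
        then show ?thesis unfolding Phi_1_diff_eq ah using t0 by simp
      qed (use Hnn qnn in auto)
    qed (simp add: Phi_top)
  qed
qed

section \<open>Attainment of the supremum and the optimal tilt\<close>

text \<open>\<open>exp (lam r)\<close> is an average of functions convex in \<open>r\<close>, so it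
  is convex and finite on the line, hence continuous; it is also positive.\<close>

lemma continuous_on_lam: "continuous_on UNIV lam"
proof -
  let ?e = "\<lambda>r. expectation (\<lambda>x. exp ((r * x)\<^sup>2 / 2))"
  have "convex_on UNIV ?e"
  proof (rule convex_onI)
    fix t u v :: real assume t: "0 < t" "t < 1"
    have "exp ((((1 - t) * u + t * v) * x)\<^sup>2 / 2)
      \<le> (1 - t) * exp ((u * x)\<^sup>2 / 2) + t * exp ((v * x)\<^sup>2 / 2)" for x
    proof -
      have "((1 - t) * u + t * v) * x = (1 - t) * (u * x) + t * (v * x)" by (simp add: algebra_simps)
      moreover have "((1 - t) * p + t * q)\<^sup>2 + t * (1 - t) * (p - q)\<^sup>2 = (1 - t) * p\<^sup>2 + t * q\<^sup>2" for p q :: real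
        by (simp add: power2_eq_square algebra_simps)
      moreover have "0 \<le> t * (1 - t) * (u * x - v * x)\<^sup>2" using t by simp
      ultimately have "(((1 - t) * u + t * v) * x)\<^sup>2 \<le> (1 - t) * (u * x)\<^sup>2 + t * (v * x)\<^sup>2"
        by (metis le_add_same_cancel1)
      then have "(((1 - t) * u + t * v) * x)\<^sup>2 / 2 \<le> (1 - t) * ((u * x)\<^sup>2 / 2) + t * ((v * x)\<^sup>2 / 2)"
        by simp
      then have "exp ((((1 - t) * u + t * v) * x)\<^sup>2 / 2) \<le> exp ((1 - t) * ((u * x)\<^sup>2 / 2) + t * ((v * x)\<^sup>2 / 2))"
        by simp
      also have "\<dots> \<le> (1 - t) * exp ((u * x)\<^sup>2 / 2) + t * exp ((v * x)\<^sup>2 / 2)"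
        using convex_onD[OF exp_convex, of t "(u * x)\<^sup>2 / 2" "(v * x)\<^sup>2 / 2"] t by simp
      finally show ?thesis .
    qed
    then have "?e ((1 - t) * u + t * v)
        \<le> expectation (\<lambda>x. (1 - t) * exp ((u * x)\<^sup>2 / 2) + t * exp ((v * x)\<^sup>2 / 2))"
      using integrable_exp_square by (intro integral_mono) auto
    also have "\<dots> = (1 - t) * ?e u + t * ?e v"
      using integrable_exp_square by simp
    finally show "?e ((1 - t) *\<^sub>R u + t *\<^sub>R v) \<le> (1 - t) * ?e u + t * ?e v" by simp
  qed auto
  then have "continuous_on UNIV ?e" by (rule convex_on_continuous[OF open_UNIV])
  then show ?thesis unfolding lam_def
    by (intro continuous_on_ln) (use exp_lam exp_not_eq_zero in metis)+
qed

text \<open>Keeps only the event \<open>k \<le> \<bar>x\<bar>\<close> in the expectation. With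
  \<open>lam_upper\<close> it ties the quadratic growth of \<open>lam\<close> to the extent of the
  support of \<gamma>.\<close>

lemma lam_lower:
  assumes "0 \<le> k" and p: "prob {x. k \<le> \<bar>x\<bar>} > 0"
  shows "r\<^sup>2 * k\<^sup>2 / 2 + ln (prob {x. k \<le> \<bar>x\<bar>}) \<le> lam r"
proof -
  let ?A = "{x::real. k \<le> \<bar>x\<bar>}"
  have [measurable]: "?A \<in> sets borel" by measurable
  have "exp (r\<^sup>2 * k\<^sup>2 / 2) * indicator ?A x \<le> exp ((r * x)\<^sup>2 / 2)" for x
  proof (cases "x \<in> ?A")
    case True
    then have "k\<^sup>2 \<le> x\<^sup>2" using assms(1) power_mono[of k "\<bar>x\<bar>" 2] by simp
    then show ?thesis using True by (simp add: power_mult_distrib mult_left_mono)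
  qed simp
  moreover have "integrable \<gamma> (indicat_real ?A)"
    by (rule integrable_real_indicator) (auto simp: emeasure_eq_measure)
  ultimately have "expectation (\<lambda>x. exp (r\<^sup>2 * k\<^sup>2 / 2) * indicator ?A x) \<le> exp (lam r)"
    unfolding exp_lam using integrable_exp_square by (intro integral_mono) auto
  then have "exp (r\<^sup>2 * k\<^sup>2 / 2) * prob ?A \<le> exp (lam r)" by simp
  then have "exp (r\<^sup>2 * k\<^sup>2 / 2 + ln (prob ?A)) \<le> exp (lam r)" using p by (simp add: exp_add)
  then show ?thesis by simp
qed

lemma lam_upper:
  assumes "AE x in \<gamma>. \<bar>x\<bar> \<le> v"
  shows "lam r \<le> r\<^sup>2 * v\<^sup>2 / 2"
proof -
  have "AE x in \<gamma>. exp ((r * x)\<^sup>2 / 2) \<le> exp (r\<^sup>2 * v\<^sup>2 / 2)"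
    using assms
  proof eventually_elim
    fix x assume "\<bar>x\<bar> \<le> v"
    then have "x\<^sup>2 \<le> v\<^sup>2" using power_mono[of "\<bar>x\<bar>" v 2] by simp
    then show "exp ((r * x)\<^sup>2 / 2) \<le> exp (r\<^sup>2 * v\<^sup>2 / 2)"
      by (simp add: power_mult_distrib mult_left_mono)
  qed
  then have "exp (lam r) \<le> expectation (\<lambda>_. exp (r\<^sup>2 * v\<^sup>2 / 2))"
    unfolding exp_lam using integrable_exp_square by (intro integral_mono_AE) auto
  then show ?thesis by simp
qed

text \<open>\<open>F\<close> is the objective of the Legendre transform in the coordinates
  \<open>b = sqrt (1 - 2*t0)\<close>, \<open>r = t1 / b\<close>. For \<open>w \<noteq> 0\<close>,
  boundedness of \<open>F\<close> forces \<gamma> to charge points beyond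
  \<open>\<bar>w\<bar>\<close>; then \<open>lam\<close> outgrows the cross term and the set where
  \<open>F \<ge> 0\<close> lies in a compact box.\<close>

lemma exists_maximizer:
  fixes w B :: real
  defines "F \<equiv> \<lambda>b r. (1 - b\<^sup>2) / 2 + r * b * w + ln b - lam r"
  assumes B: "\<And>b r. b > 0 \<Longrightarrow> F b r \<le> B"
  obtains b0 r0 where "b0 > 0" "\<And>b r. b > 0 \<Longrightarrow> F b r \<le> F b0 r0"
proof (cases "w = 0")
  case True
  \<comment> \<open>For \<open>w = 0\<close> the variables separate, and each part is maximal at
    \<open>(1, 0)\<close>.\<close>
  have "F b r \<le> F 1 0" if "b > 0" for b r
  proof -
    have "2 * ln b \<le> b\<^sup>2 - 1" using ln_le_minus_one[of "b\<^sup>2"] that by (simp add: ln_realpow)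
    then have "(1 - b\<^sup>2) / 2 + ln b \<le> 0" by argo
    then show ?thesis using lam_nonneg[of r] True by (simp add: F_def)
  qed
  then show ?thesis by (intro that[of 1 0]) auto
next
  case False
  define v where "v = \<bar>w\<bar>"
  have v: "v > 0" using False by (simp add: v_def)
  have "\<exists>k>v. prob {x. k \<le> \<bar>x\<bar>} > 0"
  proof (rule ccontr)
    assume "\<not> (\<exists>k>v. prob {x. k \<le> \<bar>x\<bar>} > 0)"
    then have "prob {x. k \<le> \<bar>x\<bar>} = 0" if "k > v" for k
      using that by (metis less_eq_real_def measure_nonneg)
    then have "AE x in \<gamma>. \<not> (v + 1 / real (Suc n) \<le> \<bar>x\<bar>)" for n
      using prob_eq_0[of "{x. v + 1 / real (Suc n) \<le> \<bar>x\<bar>}"] by (simp del: of_nat_Suc)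
    then have "AE x in \<gamma>. \<forall>n. \<not> (v + 1 / real (Suc n) \<le> \<bar>x\<bar>)"
      by (simp only: AE_all_countable) blast
    then have "AE x in \<gamma>. \<bar>x\<bar> \<le> v"
    proof eventually_elim
      fix x assume *: "\<forall>n. \<not> (v + 1 / real (Suc n) \<le> \<bar>x\<bar>)"
      show "\<bar>x\<bar> \<le> v"
      proof (rule ccontr)
        assume "\<not> \<bar>x\<bar> \<le> v"
        then obtain n where "inverse (real (Suc n)) < \<bar>x\<bar> - v"
          using reals_Archimedean[of "\<bar>x\<bar> - v"] by auto
        then have "v + 1 / real (Suc n) \<le> \<bar>x\<bar>" by (simp add: inverse_eq_divide del: of_nat_Suc)
        with * show False by blast
      qed
    qed
    \<comment> \<open>If \<open>\<bar>x\<bar> \<le> \<bar>w\<bar>\<close> almost surely, then along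
      \<open>r = b / w\<close> the quadratic terms leave at least \<open>1/2 + ln b\<close>;
      \<open>b = exp B\<close> exceeds the bound \<open>B\<close>.\<close>
    from lam_upper[OF this, of "exp B / w"]
    have "lam (exp B / w) \<le> (exp B)\<^sup>2 / 2" using False by (simp add: v_def power_divide)
    moreover have "exp B / w * exp B * w = (exp B)\<^sup>2" using False by (simp add: power2_eq_square)
    ultimately have "B + 1/2 \<le> F (exp B) (exp B / w)" unfolding F_def by (simp add: field_simps)
    then show False using B[of "exp B" "exp B / w"] by simp
  qed
  then obtain k where k: "k > v" and p: "prob {x. k \<le> \<bar>x\<bar>} > 0" by blast
  define D where "D = 1/2 - ln (prob {x. k \<le> \<bar>x\<bar>})"
  have D: "D \<ge> 0" using ln_le_minus_one[OF p] prob_le_1[of "{x. k \<le> \<bar>x\<bar>}"] unfolding D_def by linarith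
  \<comment> \<open>The coefficients left after \<open>\<bar>r\<bar> * b * v \<le> (v / k *
    b\<^sup>2 + v * k * r\<^sup>2) / 2\<close> is set against \<open>- b\<^sup>2 / 2\<close> and
    \<open>- k\<^sup>2 * r\<^sup>2 / 2\<close>; both are positive because
    \<open>k > v\<close>.\<close>
  define \<alpha> where "\<alpha> = (1 - v / k) / 2"
  define \<beta> where "\<beta> = k * (k - v) / 2"
  have \<alpha>: "\<alpha> > 0" and \<beta>: "\<beta> > 0" using k v by (auto simp: \<alpha>_def \<beta>_def)
  have F_le: "F b r \<le> D - \<alpha> * b\<^sup>2 - \<beta> * r\<^sup>2 + ln b" if "b > 0" for b r
  proof -
    have "r * b * w \<le> \<bar>r\<bar> * b * v"
      using abs_ge_self[of "r * b * w"] that by (simp add: abs_mult v_def)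
    moreover have "\<bar>r\<bar> * b * v \<le> (v / k * b\<^sup>2 + v * k * r\<^sup>2) / 2"
    proof -
      have "0 \<le> v / k * (b - k * \<bar>r\<bar>)\<^sup>2" using v k by simp
      also have "\<dots> = v / k * b\<^sup>2 + v * k * r\<^sup>2 - 2 * (\<bar>r\<bar> * b * v)"
        using k v by (simp add: power2_eq_square field_simps)
      finally show ?thesis by simp
    qed
    moreover have "r\<^sup>2 * k\<^sup>2 / 2 + ln (prob {x. k \<le> \<bar>x\<bar>}) \<le> lam r"
      using k v p by (intro lam_lower) auto
    moreover have "D - \<alpha> * b\<^sup>2 - \<beta> * r\<^sup>2 + ln b
       = (1 - b\<^sup>2) / 2 + (v / k * b\<^sup>2 + v * k * r\<^sup>2) / 2 + ln b - (r\<^sup>2 * k\<^sup>2 / 2 + ln (prob {x. k \<le> \<bar>x\<bar>}))"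
      by (simp add: D_def \<alpha>_def \<beta>_def power2_eq_square field_simps)
    ultimately show ?thesis unfolding F_def by linarith
  qed
  \<comment> \<open>\<open>F \<ge> 0\<close> gives
    \<open>\<alpha> * b\<^sup>2 + \<beta> * r\<^sup>2 \<le> D + ln b\<close>. For
    \<open>b > 1\<close> the right side is at most \<open>(D + 1) * b\<close>, which yields
    \<open>U\<close>; then \<open>D + U\<close> bounds \<open>\<beta> * r\<^sup>2\<close>. The lower
    edge \<open>exp (- D)\<close> keeps the box away from \<open>b = 0\<close>.\<close>
  define U where "U = max 1 ((D + 1) / \<alpha>)"
  define R where "R = 1 + (D + U) / \<beta>"
  have U: "U \<ge> 1" and R: "R \<ge> 0" using D \<beta> by (auto simp: U_def R_def)
  let ?K = "{exp (- D)..U} \<times> {- R..R}"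
  have inK: "(b, r) \<in> ?K" if b: "b > 0" and F: "F b r \<ge> 0" for b r
  proof -
    have main: "\<alpha> * b\<^sup>2 + \<beta> * r\<^sup>2 \<le> D + ln b" using F_le[OF b, of r] F by linarith
    have nn: "\<alpha> * b\<^sup>2 \<ge> 0" "\<beta> * r\<^sup>2 \<ge> 0" using \<alpha> \<beta> by auto
    have lnb: "ln b \<le> b" using ln_le_minus_one[OF b] by linarith
    have "- D \<le> ln b" using main nn by linarith
    then have 1: "exp (- D) \<le> b" using b by (metis exp_le_cancel_iff exp_ln)
    have 2: "b \<le> U"
    proof (cases "b \<le> 1")
      case False
      have "\<alpha> * b * b \<le> D + b" using main nn lnb by (simp add: power2_eq_square)
      also have "\<dots> \<le> (D + 1) * b" using False D mult_left_mono[of 1 b D] by (simp add: algebra_simps)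
      finally have "\<alpha> * b \<le> D + 1" using b by simp
      then show ?thesis using \<alpha> by (simp add: U_def field_simps le_max_iff_disj)
    qed (simp add: U_def)
    have "\<beta> * r\<^sup>2 \<le> D + U" using main nn lnb 2 by linarith
    then have "r\<^sup>2 \<le> (D + U) / \<beta>" using \<beta> by (simp add: field_simps)
    moreover have "\<bar>r\<bar> \<le> 1 + r\<^sup>2"
      using zero_le_power2[of "\<bar>r\<bar> - 1"] by (simp add: power2_diff)
    ultimately have "\<bar>r\<bar> \<le> R" by (simp add: R_def)
    with 1 2 show ?thesis by auto
  qed
  have F10: "F 1 0 = 0" by (simp add: F_def)
  have "continuous_on ?K (\<lambda>(b, r). F b r)"
    unfolding F_def case_prod_unfold
    by (intro continuous_intros continuous_on_compose2[OF continuous_on_lam]) (auto simp: less_le_trans[OF exp_gt_zero])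
  moreover have "compact ?K" by (intro compact_Times compact_Icc)
  moreover have "exp (- D) \<le> U" by (rule order_trans[OF _ U]) (use D in simp)
  then have "?K \<noteq> {}" using R by auto
  ultimately obtain x where x: "x \<in> ?K" "\<And>y. y \<in> ?K \<Longrightarrow> (\<lambda>(b, r). F b r) y \<le> (\<lambda>(b, r). F b r) x"
    using continuous_attains_sup[of ?K "\<lambda>(b, r). F b r"] by blast
  obtain b0 r0 where br: "x = (b0, r0)" by force
  \<comment> \<open>The box contains \<open>(1, 0)\<close>, where \<open>F\<close> vanishes, so its
    maximum is nonnegative and beats all outside points, where \<open>F < 0\<close>.\<close>
  have "F 1 0 \<le> F b0 r0" using x(2)[of "(1, 0)"] inK[of 1 0] F10 br by auto
  then have "F b r \<le> F b0 r0" if "b > 0" for b r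
    using inK[OF that, of r] x(2)[of "(b, r)"] F10 br by (cases "F b r \<ge> 0") auto
  moreover have "b0 > 0" using x(1) br less_le_trans[OF exp_gt_zero, of "- D" b0] by auto
  ultimately show ?thesis by (intro that[of b0 r0])
qed

text \<open>The competitor is the Gaussian tilted by the maximizing \<open>(s0, s1)\<close>. Maximality in \<open>t0\<close> forces
  its second moment to be \<open>1\<close>; maximality in \<open>t1\<close>, together with convexity of \<open>cgf\<close>, makes \<open>w\<close> a
  subgradient of \<open>Psi\<close> at \<open>s1\<close>.\<close>

lemma exists_optimal_tilt:
  assumes finite: "legendre_transform (Phi \<gamma>) (1, w) < \<infinity>"
  obtains \<nu> where "real_distribution \<nu>" "second_moment \<nu> = 1"
    "rate_qu \<gamma> \<nu> w + relative_entropy \<nu> std_gaussian \<le> legendre_transform (Phi \<gamma>) (1, w)"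
proof -
  interpret G: prob_space std_gaussian by (rule prob_space_std_gaussian)
  define P where "P t0 t1 = lam (t1 / sqrt (1 - 2*t0)) - ln (1 - 2*t0) / 2" for t0 t1
  define F where "F b r = (1 - b\<^sup>2) / 2 + r * b * w + ln b - lam r" for b r
  have upper: "ereal (t0 + t1 * w - P t0 t1) \<le> legendre_transform (Phi \<gamma>) (1, w)" if "t0 < 1/2" for t0 t1
    unfolding legendre_transform_def
    by (rule SUP_upper2[of "(t0, t1)"]) (use that in \<open>simp_all add: Phi_1_diff_eq P_def del: inner_Pair\<close>)
  obtain B where B: "legendre_transform (Phi \<gamma>) (1, w) \<le> ereal B"
    using finite by (cases "legendre_transform (Phi \<gamma>) (1, w)") auto
  have F_P: "F b r = (1 - b\<^sup>2) / 2 + r * b * w - P ((1 - b\<^sup>2) / 2) (r * b)" if "b > 0" for b r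
  proof -
    have "1 - 2 * ((1 - b\<^sup>2) / 2) = b\<^sup>2" by (simp add: field_simps)
    then show ?thesis unfolding F_def P_def using that by (simp only: real_sqrt_abs abs_of_pos ln_realpow) simp
  qed
  have "F b r \<le> B" if "b > 0" for b r
    using order_trans[OF upper[of "(1 - b\<^sup>2) / 2" "r * b"] B] that by (simp add: F_P)
  then obtain b0 r0 where b0: "b0 > 0" and max: "\<And>b r. b > 0 \<Longrightarrow> F b r \<le> F b0 r0"
    using exists_maximizer[of w B] unfolding F_def by blast
  define s0 where "s0 = (1 - b0\<^sup>2) / 2"
  define s1 where "s1 = r0 * b0"
  have s0: "s0 < 1/2" using b0 by (simp add: s0_def)
  \<comment> \<open>Maximality as a supporting affine function of \<open>P\<close> with slope
    \<open>(1, w)\<close>; no derivative of \<open>P\<close> is taken.\<close>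
  have opt: "P s0 s1 + (t0 - s0) + (t1 - s1) * w \<le> P t0 t1" if t0: "t0 < 1/2" for t0 t1
  proof -
    define b where "b = sqrt (1 - 2*t0)"
    have b: "b > 0" "t0 = (1 - b\<^sup>2) / 2" "t1 = t1 / b * b" using t0 by (auto simp: b_def)
    have "t0 + t1 * w - P t0 t1 = F b (t1 / b)"
      using F_P[OF b(1), of "t1 / b"] unfolding b(2,3)[symmetric] by simp
    also have "\<dots> \<le> F b0 r0" by (rule max[OF b(1)])
    also have "\<dots> = s0 + s1 * w - P s0 s1" using b0 by (simp add: F_P s0_def s1_def)
    finally show ?thesis by (simp add: algebra_simps)
  qed
  define f where "f z = s0 * z\<^sup>2 + cgf (s1 * z) - P s0 s1" for z
  have [measurable]: "f \<in> borel_measurable borel" unfolding f_def by measurable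
  define \<nu> where "\<nu> = density std_gaussian (\<lambda>z. ennreal (exp (f z)))"
  have sets_\<nu> [simp, measurable_cong]: "sets \<nu> = sets borel" by (simp add: \<nu>_def)
  \<comment> \<open>Exponential moments under \<nu> are ratios of the normalizing constants
    \<open>exp (P t0 t1)\<close>; \<open>(t0, t1) = (s0, s1)\<close> gives total mass 1.\<close>
  have tilt: "(\<integral>\<^sup>+ z. ennreal (exp ((t0 - s0) * z\<^sup>2 + (cgf (t1 * z) - cgf (s1 * z)))) \<partial>\<nu>)
      = ennreal (exp (P t0 t1 - P s0 s1))" if "t0 < 1/2" for t0 t1
  proof -
    have "(\<integral>\<^sup>+ z. ennreal (exp ((t0 - s0) * z\<^sup>2 + (cgf (t1 * z) - cgf (s1 * z)))) \<partial>\<nu>)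
      = (\<integral>\<^sup>+ z. ennreal (exp (- P s0 s1)) * ennreal (exp (t0 * z\<^sup>2 + cgf (t1 * z))) \<partial>std_gaussian)"
      unfolding \<nu>_def
      by (subst nn_integral_density)
         (auto simp: f_def ennreal_mult[symmetric] exp_add[symmetric] algebra_simps)
    also have "\<dots> = ennreal (exp (- P s0 s1)) * ennreal (exp (P t0 t1))"
      unfolding P_def nn_integral_tilt[OF that, symmetric] by (rule nn_integral_cmult) measurable
    finally show ?thesis by (simp add: ennreal_mult[symmetric] exp_add[symmetric])
  qed
  have \<nu>: "real_distribution \<nu>"
  proof (intro real_distribution.intro real_distribution_axioms.intro prob_spaceI)
    show "emeasure \<nu> (space \<nu>) = 1" using tilt[OF s0, of s1] by simp
  qed simp
  interpret \<nu>: real_distribution \<nu> by fact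
  \<comment> \<open>Half the gap to 1/2, so \<open>exp (\<delta> * z\<^sup>2)\<close> is still
    \<nu>-integrable.\<close>
  define \<delta> where "\<delta> = (1/2 - s0) / 2"
  have \<delta>: "\<delta> > 0" "s0 + \<delta> < 1/2" using s0 by (auto simp: \<delta>_def field_simps)
  have int_exp: "integrable \<nu> (\<lambda>z. exp ((t0 - s0) * z\<^sup>2 + (cgf (t1 * z) - cgf (s1 * z))))"
    if "t0 < 1/2" for t0 t1
    using tilt[OF that, of t1] by (intro integrableI_nonneg) auto
  have int2: "integrable \<nu> (\<lambda>z. z\<^sup>2)"
  proof (rule Bochner_Integration.integrable_bound)
    show "integrable \<nu> (\<lambda>z. exp (\<delta> * z\<^sup>2) / \<delta>)" using int_exp[OF \<delta>(2), of s1] by simp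
    have "\<delta> * z\<^sup>2 \<le> exp (\<delta> * z\<^sup>2)" for z
      using exp_ge_add_one_self[of "\<delta> * z\<^sup>2"] by linarith
    then have "z\<^sup>2 \<le> exp (\<delta> * z\<^sup>2) / \<delta>" for z
      using \<delta>(1) by (simp add: pos_le_divide_eq mult.commute)
    then show "AE z in \<nu>. norm (z\<^sup>2) \<le> norm (exp (\<delta> * z\<^sup>2) / \<delta>)"
      using \<delta>(1) by simp
  qed auto
  note int_cgf = integrable_cgf_mult[OF \<nu> int2]
  define \<psi> where "\<psi> t = (\<integral>z. cgf (t * z) \<partial>\<nu>)" for t
  \<comment> \<open>Optimality at \<open>(s0 + \<epsilon> * h, s1)\<close>. Both signs are
    admissible: \<open>h = \<delta>\<close> and \<open>h = - \<delta>\<close> bound the second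
    moment by 1 from below and from above.\<close>
  have m: "h \<le> h * (\<integral>z. z\<^sup>2 \<partial>\<nu>)" if h: "h \<le> \<delta>" for h
  proof -
    have "h \<le> (\<integral>z. h * z\<^sup>2 \<partial>\<nu>)"
    proof (rule \<nu>.expectation_ge_of_exp_scaled)
      show "integrable \<nu> (\<lambda>z. h * z\<^sup>2)" using int2 by simp
      show "integrable \<nu> (\<lambda>z. exp (h * z\<^sup>2))" using int_exp[of "s0 + h" s1] h \<delta> by simp
      fix \<epsilon> :: real assume \<epsilon>: "0 < \<epsilon>" "\<epsilon> \<le> 1"
      have "\<epsilon> * h \<le> \<delta>"
      proof (cases "h \<ge> 0")
        case True then show ?thesis using \<epsilon> h mult_right_mono[of \<epsilon> 1 h] by simp
      next
        case False then show ?thesis using \<epsilon> \<delta> mult_pos_neg[of \<epsilon> h] by linarith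
      qed
      then have lt: "s0 + \<epsilon> * h < 1/2" using \<delta> by linarith
      show "ennreal (exp (\<epsilon> * h)) \<le> (\<integral>\<^sup>+ z. ennreal (exp (\<epsilon> * (h * z\<^sup>2))) \<partial>\<nu>)"
        using tilt[OF lt, of s1] opt[OF lt, of s1] by (simp add: mult.assoc ennreal_leI)
    qed
    then show ?thesis using int2 by simp
  qed
  have m2: "(\<integral>z. z\<^sup>2 \<partial>\<nu>) = 1" using m[of \<delta>] m[of "- \<delta>"] \<delta> by simp
  have sub: "s * w \<le> \<psi> (s1 + s) - \<psi> s1" for s
  proof -
    have "s * w \<le> (\<integral>z. cgf ((s1 + s) * z) - cgf (s1 * z) \<partial>\<nu>)"
    proof (rule \<nu>.expectation_ge_of_exp_scaled)
      show "integrable \<nu> (\<lambda>z. cgf ((s1 + s) * z) - cgf (s1 * z))" using int_cgf by simp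
      show "integrable \<nu> (\<lambda>z. exp (cgf ((s1 + s) * z) - cgf (s1 * z)))"
        using int_exp[OF s0, of "s1 + s"] by simp
      fix \<epsilon> :: real assume \<epsilon>: "0 < \<epsilon>" "\<epsilon> \<le> 1"
      have "ennreal (exp (\<epsilon> * (s * w))) \<le> ennreal (exp (P s0 (s1 + \<epsilon> * s) - P s0 s1))"
        using opt[OF s0, of "s1 + \<epsilon> * s"] by (intro ennreal_leI) simp
      also have "\<dots> = (\<integral>\<^sup>+ z. ennreal (exp (cgf ((s1 + \<epsilon> * s) * z) - cgf (s1 * z))) \<partial>\<nu>)"
        using tilt[OF s0, of "s1 + \<epsilon> * s"] by simp
      also have "\<dots> \<le> (\<integral>\<^sup>+ z. ennreal (exp (\<epsilon> * (cgf ((s1 + s) * z) - cgf (s1 * z)))) \<partial>\<nu>)"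
        using cgf_increment_le \<epsilon> by (intro nn_integral_mono ennreal_leI) auto
      finally show "ennreal (exp (\<epsilon> * (s * w))) \<le> (\<integral>\<^sup>+ z. ennreal (exp (\<epsilon> * (cgf ((s1 + s) * z) - cgf (s1 * z)))) \<partial>\<nu>)" .
    qed
    then show ?thesis using int_cgf by (simp add: \<psi>_def)
  qed
  \<comment> \<open>By \<open>sub\<close>, the concave function \<open>t * w - \<psi> t\<close> is
    largest at \<open>s1\<close>.\<close>
  have qu: "rate_qu \<gamma> \<nu> w \<le> ereal (s1 * w - \<psi> s1)"
    unfolding rate_qu_def legendre_transform_def
  proof (rule SUP_least)
    fix t
    show "ereal (t \<bullet> w) - Psi \<gamma> \<nu> t \<le> ereal (s1 * w - \<psi> s1)"
      using sub[of "t - s1"] unfolding Psi_eq[OF \<nu> int2] \<psi>_def[symmetric] by (simp add: algebra_simps)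
  qed
  have int_f: "integrable \<nu> f" unfolding f_def using int2 int_cgf by auto
  have "(\<integral>z. f z \<partial>\<nu>) = s0 + \<psi> s1 - P s0 s1"
    unfolding f_def using int2 int_cgf \<nu>.prob_space by (simp add: m2 \<psi>_def)
  then have H: "relative_entropy \<nu> std_gaussian = ereal (s0 + \<psi> s1 - P s0 s1)"
    using relative_entropy_density[OF prob_space_std_gaussian, of f] int_f unfolding \<nu>_def[symmetric] by simp
  show ?thesis
  proof (rule that[OF \<nu>])
    show "second_moment \<nu> = 1"
      unfolding second_moment_def by (subst nn_integral_eq_integral[OF int2]) (auto simp: m2)
    \<comment> \<open>\<open>\<psi> s1\<close> cancels, and the objective at \<open>(s0, s1)\<close>
      remains.\<close>
    have "rate_qu \<gamma> \<nu> w + relative_entropy \<nu> std_gaussian \<le> ereal (s1 * w - \<psi> s1) + ereal (s0 + \<psi> s1 - P s0 s1)"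
      unfolding H by (rule add_right_mono[OF qu])
    also have "\<dots> = ereal (s0 + s1 * w - P s0 s1)" by simp
    also have "\<dots> \<le> legendre_transform (Phi \<gamma>) (1, w)" by (rule upper[OF s0])
    finally show "rate_qu \<gamma> \<nu> w + relative_entropy \<nu> std_gaussian \<le> legendre_transform (Phi \<gamma>) (1, w)" .
  qed
qed

end

theorem theorem8p3:
  fixes q :: real and \<gamma> :: "real measure"
  assumes "q > 2"
    and "\<gamma> \<in> tail_class q"
  shows "(\<forall>w::real. rate_an \<gamma> w =
            (INF \<nu>\<in>{\<nu>. real_distribution \<nu> \<and> second_moment \<nu> \<le> 1}.
               rate_qu \<gamma> \<nu> w + relative_entropy \<nu> std_gaussian
                 + ereal (1 / 2) * (1 - enn2ereal (second_moment \<nu>))))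
       \<and> (\<forall>w::real. rate_an \<gamma> w \<le> rate_qu \<gamma> std_gaussian w)"
proof (intro conjI allI)
  interpret light_tailed \<gamma> by (rule light_tailed_of_tail_class[OF assms])
  let ?J = "\<lambda>w \<nu>. rate_qu \<gamma> \<nu> w + relative_entropy \<nu> std_gaussian
                 + ereal (1 / 2) * (1 - enn2ereal (second_moment \<nu>))"
  let ?A = "{\<nu>. real_distribution \<nu> \<and> second_moment \<nu> \<le> 1}"
  have J_1: "?J w \<nu> = rate_qu \<gamma> \<nu> w + relative_entropy \<nu> std_gaussian" if "second_moment \<nu> = 1" for w \<nu>
  proof -
    have "1 - enn2ereal 1 = ereal (1 - 1)" by (metis ereal_minus(1) one_ennreal.rep_eq one_ereal_def)
    then show ?thesis using that by simp
  qed
  fix w :: real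
  have le: "rate_an \<gamma> w \<le> ?J w \<nu>" if "\<nu> \<in> ?A" for \<nu>
    using legendre_Phi_le[of \<nu> w] that by (simp add: rate_an_eq)
  show "rate_an \<gamma> w = (INF \<nu>\<in>?A. ?J w \<nu>)"
  proof (rule antisym)
    show "rate_an \<gamma> w \<le> (INF \<nu>\<in>?A. ?J w \<nu>)" by (rule INF_greatest) (rule le)
    show "(INF \<nu>\<in>?A. ?J w \<nu>) \<le> rate_an \<gamma> w"
    proof (cases "rate_an \<gamma> w = \<infinity>")
      case False
      then obtain \<nu> where \<nu>: "real_distribution \<nu>" "second_moment \<nu> = 1"
        "rate_qu \<gamma> \<nu> w + relative_entropy \<nu> std_gaussian \<le> rate_an \<gamma> w"
        using exists_optimal_tilt[of w] by (auto simp: rate_an_eq)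
      show ?thesis
      proof (rule INF_lower2)
        show "\<nu> \<in> ?A" using \<nu> by simp
        show "?J w \<nu> \<le> rate_an \<gamma> w" unfolding J_1[OF \<nu>(2)] by (rule \<nu>(3))
      qed
    qed simp
  qed
  \<comment> \<open>The Gaussian itself is a competitor, with zero entropy and no second moment
    deficit.\<close>
  have "std_gaussian \<in> ?A"
    by (simp add: real_distribution_std_gaussian second_moment_std_gaussian)
  from le[OF this] show "rate_an \<gamma> w \<le> rate_qu \<gamma> std_gaussian w"
    unfolding J_1[OF second_moment_std_gaussian]
    by (simp add: relative_entropy_self[OF prob_space_std_gaussian])
qed

end
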